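(* Let $k$ and $n$ be integers with $0\le k<n$. Let $N(n,k)$ denote the smallest integer $N$ such that every bipartite multigraph $G$ that is the union of $N$ matchings $M_1,\dots,M_N$, each of size $n$, contains a rainbow matching of size $n-k$ (with respect to $M_1,\dots,M_N$). Then $$N(n,k)\le \left\lfloor \frac{k+2}{k+1}\,n\right\rfloor-(k+1).$$ In other words, if $N=\left\lfloor \frac{k+2}{k+1}\,n\right\rfloor-(k+1)$ and a bipartite multigraph $G$ is the union of $N$ matchings $M_1,\dots,M_N$, each of size $n$, then $G$ has a rainbow matching of size $n-k$.
   Context: A matching is a set of pairwise vertex-disjoint edges; its size is its number of edges. A bipartite multigraph $G$ with vertex classes $A,B$ may have parallel edges. That $G$ is the union of $N$ matchings $M_1,\dots,M_N$ means that the edge set of $G$ is partitioned into the color classes $M_1,\dots,M_N$ of a proper edge coloring with $N$ colors; since parallel edges are allowed, the same pair of vertices may be joined by an edge in several of the $M_i$ (the $M_i$ may even coincide as sets of vertex pairs), and these count as distinct edges of different colors. A rainbow matching (with respect to $M_1,\dots,M_N$) is a matching in $G$ whose edges all come from different $M_i$'s, i.e. it contains at most one edge from each $M_i$. Thus a rainbow matching of size $m$ consists of $m$ pairwise vertex-disjoint edges $e_1,\dots,e_m$ with $e_j\in M_{i_j}$ for pairwise distinct indices $i_1,\dots,i_m\in\{1,\dots,N\}$. *)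

theory Defs
  imports Complex_Main "HOL-Library.Disjoint_Sets"
begin

text \<open>
  A multigraph is given by a set \<open>E\<close> of abstract edges and an incidence function \<open>ends\<close>, so that
  distinct (parallel) edges may have the same end vertices. The classes \<open>A\<close> and \<open>B\<close> may contain
  infinitely many (necessarily isolated) vertices.
\<close>

definition bipartite_multigraph ::
    "'v set \<Rightarrow> 'v set \<Rightarrow> 'e set \<Rightarrow> ('e \<Rightarrow> 'v set) \<Rightarrow> bool" where
  "bipartite_multigraph A B E ends \<longleftrightarrow>
     A \<inter> B = {} \<and> finite E \<and> (\<forall>e\<in>E. \<exists>a\<in>A. \<exists>b\<in>B. ends e = {a, b})"

definition matching :: "'e set \<Rightarrow> ('e \<Rightarrow> 'v set) \<Rightarrow> 'e set \<Rightarrow> bool" where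
  "matching E ends M \<longleftrightarrow>
     M \<subseteq> E \<and> (\<forall>e\<in>M. \<forall>f\<in>M. e \<noteq> f \<longrightarrow> ends e \<inter> ends f = {})"

text \<open>
  The matchings are disjoint as sets of abstract edges (the color classes of a proper edge
  coloring); as sets of vertex pairs they may overlap or coincide.
\<close>

definition union_of_matchings ::
    "'e set \<Rightarrow> ('e \<Rightarrow> 'v set) \<Rightarrow> nat \<Rightarrow> (nat \<Rightarrow> 'e set) \<Rightarrow> bool" where
  "union_of_matchings E ends N M \<longleftrightarrow>
     (\<forall>i\<in>{1..N}. matching E ends (M i)) \<and>
     disjoint_family_on M {1..N} \<and>
     E = (\<Union>i\<in>{1..N}. M i)"

definition rainbow_matching ::
    "'e set \<Rightarrow> ('e \<Rightarrow> 'v set) \<Rightarrow> nat \<Rightarrow> (nat \<Rightarrow> 'e set) \<Rightarrow> 'e set \<Rightarrow> bool" where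
  "rainbow_matching E ends N M R \<longleftrightarrow>
     matching E ends R \<and> (\<forall>i\<in>{1..N}. card (R \<inter> M i) \<le> 1)"

text \<open>
  Every bipartite multigraph (with vertices in \<open>'v\<close> and edges in \<open>'e\<close>) that is the union of
  \<open>N\<close> matchings of size \<open>n\<close> has a rainbow matching of size \<open>m\<close>.
\<close>

definition rainbow_forcing ::
    "'v itself \<Rightarrow> 'e itself \<Rightarrow> nat \<Rightarrow> nat \<Rightarrow> nat \<Rightarrow> bool" where
  "rainbow_forcing (_ :: 'v itself) (_ :: 'e itself) N n m \<longleftrightarrow>
     (\<forall>(A :: 'v set) B (E :: 'e set) ends M.
        bipartite_multigraph A B E ends \<longrightarrow>
        union_of_matchings E ends N M \<longrightarrow>
        (\<forall>i\<in>{1..N}. card (M i) = n) \<longrightarrow>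
        (\<exists>R. rainbow_matching E ends N M R \<and> card R = m))"

text \<open>
  The number \<open>N(n,k)\<close>. A definition cannot quantify over types, but since only finitely many
  edges and non-isolated vertices occur, taking both from \<open>nat\<close> covers all multigraphs up to
  isomorphism. The restriction to natural numbers is harmless: for \<open>k < n\<close> the edgeless graph
  rules out \<open>N = 0\<close>. \<open>LEAST\<close> is unspecified if no \<open>N\<close> qualifies, so a bound on this
  number is meaningful only together with a proof that some \<open>N\<close> does.
\<close>

definition rainbow_number :: "nat \<Rightarrow> nat \<Rightarrow> nat" where
  "rainbow_number n k = (LEAST N. rainbow_forcing TYPE(nat) TYPE(nat) N n (n - k))"

end

theory Submission
  imports Defs
begin

text \<open>
  Let \<open>R\<close> be a rainbow matching of size \<open>m < n - k\<close>, put \<open>d = n - m\<close>, and let \<open>u = N - m\<close> be the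
  number of colors absent from \<open>R\<close>; the choice of \<open>N\<close> gives \<open>u d > m\<close>. Suppose that \<open>R\<close> cannot be
  enlarged. Go through the absent colors one by one and maintain a set \<open>X\<close> of \<open>A\<close>-vertices covered
  by \<open>R\<close> that can be freed by alternating exchanges using only the colors processed so far. At most
  \<open>m - |X|\<close> of the \<open>m + d\<close> edges of the next color start outside the free and freeable vertices;
  each of the others must end in a vertex covered by \<open>R\<close>, as otherwise \<open>R\<close> could be enlarged. So
  the \<open>R\<close>-partners of their \<open>B\<close>-ends, at least \<open>|X| + d\<close> in number, become freeable. After \<open>u\<close>
  colors this makes \<open>u d > m\<close> freeable vertices, but \<open>R\<close> covers only \<open>m\<close>.
\<close>

section \<open>Rainbow matchings in coordinates: the two ends and the color of an edge\<close>

definition rainbow ::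
    "('e \<Rightarrow> 'a) \<Rightarrow> ('e \<Rightarrow> 'b) \<Rightarrow> ('e \<Rightarrow> 'c) \<Rightarrow> 'e set \<Rightarrow> bool" where
  "rainbow a b c R \<longleftrightarrow> inj_on a R \<and> inj_on b R \<and> inj_on c R"

lemma rainbow_subset: "rainbow a b c R \<Longrightarrow> S \<subseteq> R \<Longrightarrow> rainbow a b c S"
  unfolding rainbow_def by (meson inj_on_subset)

lemma rainbow_insert:
  assumes "rainbow a b c R" "a e \<notin> a ` R" "b e \<notin> b ` R" "c e \<notin> c ` R"
  shows "rainbow a b c (insert e R)"
  using assms unfolding rainbow_def inj_on_insert by (metis Diff_subset image_mono subsetD)

text \<open>
  The last condition says that an edge of \<open>R\<close> at a vertex outside \<open>X\<close> still belongs to \<open>R'\<close>, so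
  that it can be exchanged in a later step.
\<close>

definition frees ::
    "('e \<Rightarrow> 'a) \<Rightarrow> ('e \<Rightarrow> 'b) \<Rightarrow> ('e \<Rightarrow> 'c) \<Rightarrow> 'e set \<Rightarrow> 'e set \<Rightarrow> 'c set \<Rightarrow> 'a set \<Rightarrow> 'a
      \<Rightarrow> 'e set \<Rightarrow> bool" where
  "frees a b c E R V X x R' \<longleftrightarrow>
     R' \<subseteq> E \<and> rainbow a b c R' \<and> card R' = card R \<and> b ` R' = b ` R \<and> x \<notin> a ` R' \<and>
     c ` R' \<subseteq> c ` R \<union> V \<and> a ` (R - R') \<subseteq> X"

lemma frees_mono:
  "frees a b c E R V X x R' \<Longrightarrow> V \<subseteq> W \<Longrightarrow> X \<subseteq> Y \<Longrightarrow> frees a b c E R W Y x R'"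
  unfolding frees_def by (meson Un_mono order_refl subset_trans)

text \<open>Since \<open>a r\<close> lies outside \<open>X\<close>, the edge \<open>r\<close>
  survives in \<open>R'\<close>. As \<open>R'\<close> avoids the vertex \<open>a e\<close> and the
  color of \<open>e\<close>, the swap of \<open>r\<close> for \<open>e\<close> can clash only at the
  common \<open>B\<close>-end, which \<open>r\<close> vacates. The covered \<open>B\<close>-vertices
  stay the same and \<open>a r\<close> becomes free.\<close>

lemma frees_exchange:
  assumes fr: "frees a b c E R V X (a e) R'" and fin: "finite E"
    and e: "e \<in> E" "c e \<notin> c ` R \<union> V"
    and r: "r \<in> R" "b r = b e" "a r \<notin> X"
  shows "frees a b c E R (insert (c e) V) (insert (a r) X) (a r) (insert e (R' - {r}))"
proof -
  have R': "R' \<subseteq> E" "rainbow a b c R'" "card R' = card R" "b ` R' = b ` R" "a e \<notin> a ` R'"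
    "c ` R' \<subseteq> c ` R \<union> V" "a ` (R - R') \<subseteq> X"
    using fr unfolding frees_def by auto
  have rR': "r \<in> R'" using R'(7) r by blast
  have inj: "inj_on a R'" "inj_on b R'" using R'(2) unfolding rainbow_def by auto
  have finR': "finite R'" using R'(1) fin finite_subset by blast
  have ce: "c e \<notin> c ` R'" using e R'(6) by blast
  then have eR': "e \<notin> R'" by blast
  have be: "b e \<notin> b ` (R' - {r})"
    using inj(2) rR' r(2) unfolding inj_on_def by fastforce
  have "rainbow a b c (insert e (R' - {r}))"
    using R'(5) ce be by (intro rainbow_insert rainbow_subset[OF R'(2)]) auto
  moreover have "card (insert e (R' - {r})) = card R"
    using eR' rR' finR' R'(3) card_Suc_Diff1[OF finR' rR'] by simp
  moreover have "b ` insert e (R' - {r}) = b ` R"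
    by (metis R'(4) rR' r(2) image_insert insert_Diff)
  moreover have "a r \<notin> a ` insert e (R' - {r})"
  proof -
    have "a r \<notin> a ` (R' - {r})" by (simp add: inj_on_image_mem_iff[OF inj(1) rR'])
    moreover have "a r \<noteq> a e" using R'(5) rR' by (metis imageI)
    ultimately show ?thesis by simp
  qed
  moreover have "c ` insert e (R' - {r}) \<subseteq> c ` R \<union> insert (c e) V"
    using R'(6) by blast
  moreover have "a ` (R - insert e (R' - {r})) \<subseteq> insert (a r) X"
    using R'(7) by blast
  ultimately show ?thesis
    using R'(1) e(1) unfolding frees_def by blast
qed

section \<open>Counting the freeable vertices\<close>

lemma freeable_vertices:
  fixes a :: "'e \<Rightarrow> 'a" and b :: "'e \<Rightarrow> 'b" and c :: "'e \<Rightarrow> 'c"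
  assumes fin: "finite E" and R: "R \<subseteq> E" "rainbow a b c R"
    and no_aug: "\<not> (\<exists>R'\<subseteq>E. rainbow a b c R' \<and> card R' = Suc (card R))"
    and V: "finite V" "V \<inter> c ` R = {}"
    and color: "\<And>v. v \<in> V \<Longrightarrow> inj_on a {e\<in>E. c e = v}" "\<And>v. v \<in> V \<Longrightarrow> inj_on b {e\<in>E. c e = v}"
      "\<And>v. v \<in> V \<Longrightarrow> card {e\<in>E. c e = v} \<ge> card R + d"
  shows "\<exists>X\<subseteq>a ` R. card V * d \<le> card X \<and>
           (\<forall>x. x \<notin> a ` R - X \<longrightarrow> (\<exists>R'. frees a b c E R V X x R'))"
  using V color
proof (induction V rule: finite_induct)
  case empty
  then show ?case
    \<comment> \<open>With no color processed, \<open>R\<close> itself is the witness for every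
      vertex that it does not cover.\<close>
    using R by (intro exI[of _ "{}"]) (auto simp: frees_def)
next
  case (insert v V)
  have "\<exists>X\<subseteq>a ` R. card V * d \<le> card X \<and>
      (\<forall>x. x \<notin> a ` R - X \<longrightarrow> (\<exists>R'. frees a b c E R V X x R'))"
    by (rule insert.IH) (use insert.prems in blast)+
  then obtain X where X: "X \<subseteq> a ` R" "card V * d \<le> card X"
    "\<And>x. x \<notin> a ` R - X \<Longrightarrow> \<exists>R'. frees a b c E R V X x R'"
    by blast
  have finR: "finite R" using R fin finite_subset by blast
  have injR: "inj_on a R" "inj_on b R" using R unfolding rainbow_def by auto
  have cv: "v \<notin> c ` R \<union> V" using insert.prems(1) insert.hyps by blast
  define C where "C = {e\<in>E. c e = v}"
  define S where "S = {e\<in>C. a e \<notin> a ` R - X}"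
  have C: "finite C" "inj_on a C" "inj_on b C" "card C \<ge> card R + d"
    using insert.prems fin unfolding C_def by auto
  have finX: "finite X" using X(1) finR finite_subset by blast
  have "card (C - S) = card (a ` (C - S))"
    using C(2) by (metis card_image Diff_subset inj_on_subset)
  also have "\<dots> \<le> card (a ` R - X)"
    using finR unfolding S_def by (intro card_mono) auto
  also have "\<dots> = card R - card X"
    using X(1) finX injR(1) by (simp add: card_Diff_subset card_image)
  finally have "card (C - S) \<le> card R - card X" .
  moreover have "card X \<le> card R"
    using X(1) finR injR(1) by (metis card_image card_mono finite_imageI)
  moreover have "card C = card S + card (C - S)"
  proof -
    have "S \<subseteq> C" unfolding S_def by blast
    then show ?thesis
      using C(1) by (metis card_Diff_subset card_mono finite_subset le_add_diff_inverse)
  qed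
  ultimately have S_ge: "card S \<ge> card X + d" using C(4) by linarith
  \<comment> \<open>Otherwise \<open>e\<close> could be added to the \<open>R'\<close> that frees
    \<open>a e\<close>: the color \<open>v\<close> is new to \<open>R'\<close>, and
    \<open>R'\<close> covers the same \<open>B\<close>-vertices as \<open>R\<close>.\<close>
  have bS: "b e \<in> b ` R" if e: "e \<in> S" for e
  proof (rule ccontr)
    assume be: "b e \<notin> b ` R"
    have e': "e \<in> E" "c e = v" "a e \<notin> a ` R - X"
      using e unfolding S_def C_def by auto
    then obtain R' where R': "frees a b c E R V X (a e) R'" using X(3) by blast
    then have R'E: "R' \<subseteq> E" and ce: "c e \<notin> c ` R'"
      using cv e' unfolding frees_def by auto
    then have "rainbow a b c (insert e R')"
      using R' be by (intro rainbow_insert) (auto simp: frees_def)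
    moreover have "card (insert e R') = Suc (card R)"
    proof -
      have "finite R'" "e \<notin> R'" using R'E fin finite_subset ce by auto
      then show ?thesis using R' by (simp add: frees_def)
    qed
    ultimately show False
      using no_aug R'E e'(1) by blast
  qed
  define R0 where "R0 = {r\<in>R. b r \<in> b ` S}"
  have "card R0 = card S"
  proof -
    have "b ` R0 = b ` R \<inter> b ` S" unfolding R0_def by blast
    moreover have "b ` S \<subseteq> b ` R" using bS by (rule image_subsetI)
    ultimately have "b ` R0 = b ` S" by blast
    moreover have "inj_on b R0" "inj_on b S"
      using injR(2) C(3) unfolding R0_def S_def inj_on_def by auto
    ultimately show ?thesis by (metis card_image)
  qed
  moreover have "card (a ` R0) = card R0"
    using injR(1) unfolding R0_def by (intro card_image) (auto simp: inj_on_def)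
  moreover have "card (a ` R0) \<le> card (X \<union> a ` R0)"
    using finX finR unfolding R0_def by (intro card_mono) auto
  \<comment> \<open>The images of \<open>R0\<close> alone supply the count. The old \<open>X\<close>
    is kept because earlier exchanges may already have removed the edges of \<open>R\<close> at its
    vertices.\<close>
  ultimately have "card (insert v V) * d \<le> card (X \<union> a ` R0)"
    using S_ge X(2) insert.hyps by simp
  moreover have "X \<union> a ` R0 \<subseteq> a ` R" using X(1) unfolding R0_def by blast
  moreover have "\<exists>R'. frees a b c E R (insert v V) (X \<union> a ` R0) x R'"
    if x: "x \<notin> a ` R - (X \<union> a ` R0)" for x
  proof (cases "x \<notin> a ` R - X")
    case True
    then obtain R' where "frees a b c E R V X x R'" using X(3) by blast
    then show ?thesis by (blast intro: frees_mono)
  next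
    case False
    \<comment> \<open>A newly freeable vertex needs one more exchange: first free the
      \<open>A\<close>-end of a suitable \<open>e\<close> in \<open>S\<close> with the old colors,
      then swap in \<open>e\<close>.\<close>
    then have "x \<in> a ` R0" "x \<notin> X" using x by simp_all
    then obtain r where r: "r \<in> R0" "x = a r" "a r \<notin> X" by fast
    then obtain e where e: "e \<in> S" "b r = b e" unfolding R0_def by fast
    have e': "e \<in> E" "c e = v" "a e \<notin> a ` R - X"
      using e unfolding S_def C_def by auto
    then obtain R' where R': "frees a b c E R V X (a e) R'" using X(3) by blast
    have "frees a b c E R (insert (c e) V) (insert (a r) X) (a r) (insert e (R' - {r}))"
      using r e e' cv by (intro frees_exchange[OF R' fin]) (auto simp: R0_def)
    then have "frees a b c E R (insert v V) (X \<union> a ` R0) x (insert e (R' - {r}))"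
      unfolding r(2) e'(2) by (rule frees_mono) (use r(1) in auto)
    then show ?thesis by (rule exI)
  qed
  ultimately show ?case by blast
qed

section \<open>Growing a rainbow matching edge by edge\<close>

lemma rainbow_augment:
  assumes fin: "finite E" and R: "R \<subseteq> E" "rainbow a b c R"
    and V: "finite V" "V \<inter> c ` R = {}"
    and color: "\<And>v. v \<in> V \<Longrightarrow> inj_on a {e\<in>E. c e = v}" "\<And>v. v \<in> V \<Longrightarrow> inj_on b {e\<in>E. c e = v}"
      "\<And>v. v \<in> V \<Longrightarrow> card {e\<in>E. c e = v} \<ge> card R + d"
    and many: "card R < card V * d"
  shows "\<exists>R'\<subseteq>E. rainbow a b c R' \<and> card R' = Suc (card R)"
proof (rule ccontr)
  assume "\<not> ?thesis"
  from freeable_vertices[OF fin R this V color]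
  obtain X where X: "X \<subseteq> a ` R" "card V * d \<le> card X" by blast
  have "finite R" using R(1) fin finite_subset by blast
  then have "card X \<le> card R"
    using X(1) by (meson card_image_le card_mono finite_imageI le_trans)
  then show False using X(2) many by linarith
qed

text \<open>Starting from the empty set, each size below \<open>n - k\<close> admits an
  augmentation. The additive form of \<open>N\<close> avoids truncated subtraction.\<close>

lemma rainbow_exists:
  fixes c :: "'e \<Rightarrow> nat"
  assumes fin: "finite E" and cE: "c ` E \<subseteq> {1..N}"
    and color: "\<And>v. v \<in> {1..N} \<Longrightarrow> inj_on a {e\<in>E. c e = v}"
      "\<And>v. v \<in> {1..N} \<Longrightarrow> inj_on b {e\<in>E. c e = v}"
      "\<And>v. v \<in> {1..N} \<Longrightarrow> card {e\<in>E. c e = v} = n"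
    and N: "N + (k + 1) = n + n div (k + 1)"
    and j: "j \<le> n - k"
  shows "\<exists>R\<subseteq>E. rainbow a b c R \<and> card R = j"
  using j
proof (induction j)
  case 0
  then show ?case by (intro exI[of _ "{}"]) (auto simp: rainbow_def)
next
  case (Suc j)
  then obtain R where R: "R \<subseteq> E" "rainbow a b c R" "card R = j" by auto
  define V where "V = {1..N} - c ` R"
  have sub: "c ` R \<subseteq> {1..N}" using R cE by blast
  have "card (c ` R) = j" using R unfolding rainbow_def by (simp add: card_image)
  then have cardV: "card V = N - j"
    using sub unfolding V_def by (simp add: card_Diff_subset finite_subset)
  \<comment> \<open>The factors are at least \<open>n div (k + 1)\<close> and \<open>k + 1\<close>,
    so the product is at least \<open>n - n mod (k + 1)\<close>, hence at least
    \<open>n - k\<close>, which exceeds \<open>j\<close>.\<close>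
  have "j < (N - j) * (n - j)"
  proof -
    have "n div (k + 1) \<le> N - j" "k + 1 \<le> n - j" using Suc.prems N by linarith+
    then have "n div (k + 1) * (k + 1) \<le> (N - j) * (n - j)" by (rule mult_le_mono)
    moreover have "n mod (k + 1) < k + 1" by simp
    moreover have "n div (k + 1) * (k + 1) + n mod (k + 1) = n" by (rule div_mult_mod_eq)
    ultimately show ?thesis using Suc.prems by linarith
  qed
  then have "\<exists>R'\<subseteq>E. rainbow a b c R' \<and> card R' = Suc (card R)"
    using R color Suc.prems cardV
    by (intro rainbow_augment[where V = V and d = "n - j", OF fin]) (auto simp: V_def)
  then show ?case using R by simp
qed

section \<open>Transfer to bipartite multigraphs\<close>

lemma rainbow_forcing_bound:
  assumes N: "N + (k + 1) = n + n div (k + 1)"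
  shows "rainbow_forcing TYPE('v) TYPE('e) N n (n - k)"
  unfolding rainbow_forcing_def
proof (intro allI impI)
  fix A B :: "'v set" and E :: "'e set" and ends M
  assume G: "bipartite_multigraph A B E ends" and U: "union_of_matchings E ends N M"
    and size: "\<forall>i\<in>{1..N}. card (M i) = n"
  have fin: "finite E" and AB: "A \<inter> B = {}" using G unfolding bipartite_multigraph_def by auto
  have "\<forall>e\<in>E. \<exists>p. fst p \<in> A \<and> snd p \<in> B \<and> ends e = {fst p, snd p}"
    using G unfolding bipartite_multigraph_def by fastforce
  then obtain p where "\<forall>e\<in>E. fst (p e) \<in> A \<and> snd (p e) \<in> B \<and> ends e = {fst (p e), snd (p e)}"
    by (rule exE[OF bchoice])
  then obtain a b where ab: "\<And>e. e \<in> E \<Longrightarrow> a e \<in> A" "\<And>e. e \<in> E \<Longrightarrow> b e \<in> B"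
    "\<And>e. e \<in> E \<Longrightarrow> ends e = {a e, b e}"
    using that[of "fst \<circ> p" "snd \<circ> p"] by simp
  \<comment> \<open>Because \<open>A\<close> and \<open>B\<close> are disjoint, two edges can meet
    only in their \<open>A\<close>-ends or in their \<open>B\<close>-ends, so vertex-disjointness is
    injectivity in each coordinate.\<close>
  have matching_iff: "matching E ends S \<longleftrightarrow> S \<subseteq> E \<and> inj_on a S \<and> inj_on b S" for S
  proof -
    have disj: "ends e \<inter> ends f = {} \<longleftrightarrow> a e \<noteq> a f \<and> b e \<noteq> b f" if "e \<in> E" "f \<in> E" for e f
    proof -
      have "a e \<noteq> b f" "b e \<noteq> a f"
        by (metis ab(1) ab(2) that AB disjoint_iff)+
      then show ?thesis unfolding ab(3)[OF that(1)] ab(3)[OF that(2)] by auto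
    qed
    have "S \<subseteq> E \<Longrightarrow> (\<forall>e\<in>S. \<forall>f\<in>S. e \<noteq> f \<longrightarrow> ends e \<inter> ends f = {}) \<longleftrightarrow>
        (\<forall>e\<in>S. \<forall>f\<in>S. e \<noteq> f \<longrightarrow> a e \<noteq> a f \<and> b e \<noteq> b f)"
      by (intro ball_cong refl imp_cong disj) auto
    then show ?thesis unfolding matching_def inj_on_def by meson
  qed
  have M: "\<And>i. i \<in> {1..N} \<Longrightarrow> matching E ends (M i)" "disjoint_family_on M {1..N}"
    "E = (\<Union>i\<in>{1..N}. M i)"
    using U unfolding union_of_matchings_def by auto
  obtain c where c: "\<And>e. e \<in> E \<Longrightarrow> c e \<in> {1..N} \<and> e \<in> M (c e)"
    using M(3) by (metis UN_E)
  \<comment> \<open>Disjointness of the matchings leaves no choice for the color of an edge.\<close>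
  have Mi: "{e\<in>E. c e = i} = M i" if i: "i \<in> {1..N}" for i
  proof
    show "{e\<in>E. c e = i} \<subseteq> M i" using c by blast
    show "M i \<subseteq> {e\<in>E. c e = i}"
    proof
      fix e assume e: "e \<in> M i"
      then have eE: "e \<in> E" using M(3) i by blast
      then have "c e = i"
        using c[OF eE] M(2) i e unfolding disjoint_family_on_def by blast
      then show "e \<in> {e\<in>E. c e = i}" using eE by blast
    qed
  qed
  have "\<exists>R\<subseteq>E. rainbow a b c R \<and> card R = n - k"
    using Mi M(1) size c matching_iff
    by (intro rainbow_exists[OF fin _ _ _ _ N order_refl]) auto
  then obtain R where R: "R \<subseteq> E" "rainbow a b c R" "card R = n - k" by blast
  have "card (R \<inter> M i) \<le> 1" if i: "i \<in> {1..N}" for i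
  proof -
    have "finite (R \<inter> M i)" using R(1) fin finite_subset by blast
    moreover have "e = f" if "e \<in> R \<inter> M i" "f \<in> R \<inter> M i" for e f
      using that R(2) unfolding rainbow_def inj_on_def Mi[OF i, symmetric] by auto
    ultimately show ?thesis by (simp add: card_le_Suc0_iff_eq)
  qed
  then have "rainbow_matching E ends N M R"
    using R matching_iff unfolding rainbow_matching_def rainbow_def by blast
  then show "\<exists>R. rainbow_matching E ends N M R \<and> card R = n - k" using R(3) by blast
qed

section \<open>The floor expression and the final bound\<close>

lemma floor_rainbow_bound:
  "\<lfloor>(real k + 2) / (real k + 1) * real n\<rfloor> = int n + int (n div (k + 1))"
proof -
  have "(real k + 2) / (real k + 1) * real n = of_nat n + of_nat n / of_nat (k + 1)"
    by (simp add: field_simps)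
  also have "\<lfloor>\<dots>\<rfloor> = int n + \<lfloor>(of_nat n :: real) / of_nat (k + 1)\<rfloor>"
    by (metis floor_add_int of_int_of_nat_eq add.commute)
  also have "\<dots> = int n + int (n div (k + 1))"
    by (simp only: floor_divide_of_nat_eq)
  finally show ?thesis .
qed

theorem theorem2:
  fixes k n :: nat
  assumes "k < n"
  shows "int (rainbow_number n k)
           \<le> \<lfloor>(real k + 2) / (real k + 1) * real n\<rfloor> - (int k + 1) \<and>
         (\<forall>N. int N = \<lfloor>(real k + 2) / (real k + 1) * real n\<rfloor> - (int k + 1) \<longrightarrow>
              rainbow_forcing TYPE('v) TYPE('e) N n (n - k))"
proof
  define N where "N = n + n div (k + 1) - (k + 1)"
  \<comment> \<open>From \<open>k < n\<close> follows \<open>k + 1 \<le> n\<close>, so the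
    subtraction in \<open>N\<close> is exact.\<close>
  have N: "N + (k + 1) = n + n div (k + 1)" using assms unfolding N_def by simp
  \<comment> \<open>Forcing at \<open>N\<close> over \<open>nat\<close> also shows that the
    \<open>LEAST\<close> ranges over a nonempty set.\<close>
  have "rainbow_number n k \<le> N"
    unfolding rainbow_number_def by (intro Least_le rainbow_forcing_bound N)
  then show "int (rainbow_number n k)
      \<le> \<lfloor>(real k + 2) / (real k + 1) * real n\<rfloor> - (int k + 1)"
    using N unfolding floor_rainbow_bound by linarith
  show "\<forall>N. int N = \<lfloor>(real k + 2) / (real k + 1) * real n\<rfloor> - (int k + 1) \<longrightarrow>
      rainbow_forcing TYPE('v) TYPE('e) N n (n - k)"
    unfolding floor_rainbow_bound by (intro allI impI rainbow_forcing_bound) linarith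
qed

end
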